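(* Let $A$ be a $B_1$-algebra. For each saturated ideal $I$ of $A$, one has $$r(I)=\bigcap_{\mathcal P\in Pr_s(A);\ I\subseteq\mathcal P}\mathcal P,$$ where $r(I):=\{x\in A\mid(\exists n\geq 1)\ x^n\in I\}$.
   Context: A (commutative) $B_1$-algebra is a commutative semiring $A$ with $0$ (absorbing for multiplication) and $1$, in which $1+1=1$ (so $x+x=x$ for all $x\in A$). An ideal of $A$ is a subset containing $0$, stable under addition and under multiplication by elements of $A$. An ideal $\mathcal P$ is prime if $\mathcal P\neq A$ and $ab\in\mathcal P$ implies $a\in\mathcal P$ or $b\in\mathcal P$. A congruence on $A$ is an equivalence relation compatible with addition and multiplication. For a congruence $\mathcal R$, $I(\mathcal R):=\{x\in A\mid x\,\mathcal R\,0\}$, an ideal. An ideal $J$ is saturated if $J=I(\mathcal R)$ for some congruence $\mathcal R$. $Pr_s(A)$ is the set of saturated prime ideals of $A$. An empty intersection of ideals of $A$ is $A$. *)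

theory Defs
  imports Main
begin

(* The class comm_semiring_1 is avoided because it includes zero_neq_one,
   which would exclude the trivial algebra, where 0 = 1. *)
class B1_algebra = comm_semiring_0 + comm_monoid_mult +
  assumes B1_one_plus_one: "1 + 1 = 1"

definition is_ideal :: "'a::B1_algebra set \<Rightarrow> bool" where
  "is_ideal J \<longleftrightarrow>
     0 \<in> J \<and> (\<forall>x\<in>J. \<forall>y\<in>J. x + y \<in> J) \<and> (\<forall>a. \<forall>x\<in>J. a * x \<in> J)"

definition is_prime_ideal :: "'a::B1_algebra set \<Rightarrow> bool" where
  "is_prime_ideal P \<longleftrightarrow>
     is_ideal P \<and> P \<noteq> UNIV \<and> (\<forall>a b. a * b \<in> P \<longrightarrow> a \<in> P \<or> b \<in> P)"

definition is_congruence :: "'a::B1_algebra rel \<Rightarrow> bool" where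
  "is_congruence R \<longleftrightarrow>
     equiv UNIV R \<and>
     (\<forall>a b c d. (a, b) \<in> R \<longrightarrow> (c, d) \<in> R \<longrightarrow>
        (a + c, b + d) \<in> R \<and> (a * c, b * d) \<in> R)"

definition ideal_of_congruence :: "'a::B1_algebra rel \<Rightarrow> 'a set" where
  "ideal_of_congruence R = {x. (x, 0) \<in> R}"

definition is_saturated_ideal :: "'a::B1_algebra set \<Rightarrow> bool" where
  "is_saturated_ideal J \<longleftrightarrow>
     is_ideal J \<and> (\<exists>R. is_congruence R \<and> J = ideal_of_congruence R)"

definition saturated_primes :: "'a::B1_algebra set set" where
  "saturated_primes = {P. is_prime_ideal P \<and> is_saturated_ideal P}"

definition radical :: "'a::B1_algebra set \<Rightarrow> 'a set" where
  "radical I = {x. \<exists>n\<ge>1. x ^ n \<in> I}"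

end

theory Submission imports Defs
begin

text \<open>
  An ideal is saturated iff it is downward closed for the order in which \<open>x\<close> is below \<open>y\<close>
  when \<open>y = x + z\<close> for some \<open>z\<close>. Given \<open>x\<close> outside the radical of \<open>I\<close>, Zorn's lemma yields
  a saturated ideal \<open>P\<close> containing \<open>I\<close> and maximal among those containing no positive power
  of \<open>x\<close>. It is prime: if \<open>a\<close> and \<open>b\<close> lie outside \<open>P\<close>, then by maximality
  \<open>x ^ m\<close> is below some \<open>p + c * a\<close> and \<open>x ^ n\<close> below some \<open>q + d * b\<close> with \<open>p\<close>, \<open>q\<close> in \<open>P\<close>;
  if \<open>a * b\<close> were in \<open>P\<close>, the product of these bounds, and hence \<open>x ^ (m + n)\<close>,
  would be in \<open>P\<close>.
\<close>

lemma B1_add_idem: "x + x = (x::'a::B1_algebra)"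
  by (metis B1_one_plus_one distrib_left mult_1_right)

lemma is_idealD:
  assumes "is_ideal J"
  shows "0 \<in> J" "x \<in> J \<Longrightarrow> y \<in> J \<Longrightarrow> x + y \<in> J" "x \<in> J \<Longrightarrow> a * x \<in> J"
  using assms by (auto simp: is_ideal_def)

text \<open>Adding \<open>x\<close> to both sides of \<open>x + y\<close> ~ \<open>0\<close> gives
  \<open>x + y\<close> ~ \<open>x\<close> by idempotence, hence \<open>x\<close> ~
  \<open>0\<close>.\<close>

lemma saturated_ideal_downward_closed:
  assumes "is_saturated_ideal J" "x + y \<in> J"
  shows "x \<in> J"
proof -
  obtain R where R: "is_congruence R" and J: "J = {x. (x, 0) \<in> R}"
    using assms(1) by (auto simp: is_saturated_ideal_def ideal_of_congruence_def)
  have equiv: "equiv UNIV R"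
    and add: "\<And>a b c d. (a, b) \<in> R \<Longrightarrow> (c, d) \<in> R \<Longrightarrow> (a + c, b + d) \<in> R"
    using R by (auto simp: is_congruence_def)
  have xy: "(x + y, 0) \<in> R"
    using assms(2) J by simp
  moreover have "(x, x) \<in> R"
    using equiv by (auto simp: equiv_def refl_on_def)
  ultimately have "(x + (x + y), x + 0) \<in> R"
    by (intro add)
  then have "(x + y, x) \<in> R"
    by (simp add: B1_add_idem flip: add.assoc)
  with xy equiv have "(x, 0) \<in> R"
    by (meson equiv_def symD transD)
  with J show ?thesis
    by simp
qed

text \<open>The witness is the congruence that identifies two elements when they become equal after
  adding some common element of \<open>J\<close>.\<close>

lemma saturated_idealI:
  assumes J: "is_ideal J" and down: "\<And>x y. x + y \<in> J \<Longrightarrow> x \<in> J"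
  shows "is_saturated_ideal J"
proof -
  define R where "R = {(x, y). \<exists>z\<in>J. x + z = y + z}"
  have "refl R"
    using is_idealD(1)[OF J] by (auto simp: R_def refl_on_def)
  moreover have "sym R"
    by (auto simp: R_def sym_def) metis
  moreover have "trans R"
  proof (rule transI)
    fix a b c
    assume "(a, b) \<in> R" "(b, c) \<in> R"
    then obtain z w where "z \<in> J" "a + z = b + z" "w \<in> J" "b + w = c + w"
      by (auto simp: R_def)
    then have "z + w \<in> J" "a + (z + w) = c + (z + w)"
      by (auto intro: is_idealD(2)[OF J]) (metis add.assoc add.commute)
    then show "(a, c) \<in> R"
      by (auto simp: R_def)
  qed
  moreover have "(a + c, b + d) \<in> R" "(a * c, b * d) \<in> R" if R: "(a, b) \<in> R" "(c, d) \<in> R" for a b c d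
  proof -
    obtain z w where z: "z \<in> J" "a + z = b + z" and w: "w \<in> J" "c + w = d + w"
      using R by (auto simp: R_def)
    have "z + w \<in> J"
      by (intro is_idealD(2)[OF J] z w)
    moreover have "a + c + (z + w) = b + d + (z + w)"
      using z(2) w(2) by (metis add.assoc add.left_commute)
    ultimately show "(a + c, b + d) \<in> R"
      by (auto simp: R_def)
    \<comment> \<open>The summand \<open>c * z\<close> turns \<open>a * c\<close> into
      \<open>b * c\<close>, and \<open>b * w\<close> then turns \<open>b * c\<close> into
      \<open>b * d\<close>.\<close>
    have "c * z + b * w \<in> J"
      by (intro is_idealD[OF J] z w)
    moreover have "a * c + (c * z + b * w) = b * d + (c * z + b * w)"
    proof -
      have "a * c + (c * z + b * w) = c * (a + z) + b * w"
        by (simp add: algebra_simps)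
      also have "\<dots> = b * (c + w) + c * z"
        unfolding z(2) by (simp add: algebra_simps)
      also have "\<dots> = b * d + (c * z + b * w)"
        unfolding w(2) by (simp add: algebra_simps)
      finally show ?thesis .
    qed
    ultimately show "(a * c, b * d) \<in> R"
      by (auto simp: R_def)
  qed
  ultimately have "is_congruence R"
    by (auto simp: is_congruence_def equiv_def)
  \<comment> \<open>If \<open>x + z = 0 + z\<close> with \<open>z\<close> in \<open>J\<close>, then
    \<open>x + z\<close> is in \<open>J\<close>, and so is \<open>x\<close>; conversely, for
    \<open>x\<close> in \<open>J\<close>, idempotence lets \<open>x\<close> itself serve as
    \<open>z\<close>.\<close>
  moreover have "J = ideal_of_congruence R"
    unfolding ideal_of_congruence_def R_def using down B1_add_idem by auto metis
  ultimately show ?thesis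
    using J by (auto simp: is_saturated_ideal_def)
qed

lemma prime_ideal_power_mem:
  assumes "is_prime_ideal P" "x ^ n \<in> P"
  shows "x \<in> P"
  using assms(2)
proof (induction n)
  case 0
  \<comment> \<open>Here the hypothesis says that \<open>1\<close> lies in \<open>P\<close>, which
    forces \<open>P\<close> to be everything.\<close>
  then have "y \<in> P" for y
    using assms(1) is_idealD(3)[of P 1 y] by (simp add: is_prime_ideal_def)
  then show ?case .
next
  case (Suc n)
  then show ?case
    using assms(1) by (auto simp: is_prime_ideal_def)
qed

text \<open>For an ideal \<open>P\<close>, this is the smallest saturated ideal containing
  \<open>P\<close> and \<open>a\<close>: the downward closure of the ideal sum of \<open>P\<close>
  and the multiples of \<open>a\<close>.\<close>

definition saturated_adjoin :: "'a::B1_algebra set \<Rightarrow> 'a \<Rightarrow> 'a set" where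
  "saturated_adjoin P a = {y. \<exists>p\<in>P. \<exists>c z. y + z = p + c * a}"

lemma saturated_adjoin_is_saturated:
  assumes P: "is_ideal P"
  shows "is_saturated_ideal (saturated_adjoin P a)"
proof (rule saturated_idealI)
  show "is_ideal (saturated_adjoin P a)"
    unfolding is_ideal_def
  proof (intro conjI allI ballI)
    have "0 + 0 = 0 + 0 * a"
      by simp
    then show "0 \<in> saturated_adjoin P a"
      unfolding saturated_adjoin_def using is_idealD(1)[OF P] by blast
  next
    fix x y
    assume "x \<in> saturated_adjoin P a" "y \<in> saturated_adjoin P a"
    then obtain p c z q d w where
      x: "p \<in> P" "x + z = p + c * a" and y: "q \<in> P" "y + w = q + d * a"
      by (auto simp: saturated_adjoin_def)
    have "x + y + (z + w) = (x + z) + (y + w)"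
      by (simp add: ac_simps)
    also have "\<dots> = (p + q) + (c + d) * a"
      unfolding x(2) y(2) by (simp add: algebra_simps)
    finally show "x + y \<in> saturated_adjoin P a"
      unfolding saturated_adjoin_def using is_idealD(2)[OF P x(1) y(1)] by blast
  next
    fix b x
    assume "x \<in> saturated_adjoin P a"
    then obtain p c z where x: "p \<in> P" "x + z = p + c * a"
      by (auto simp: saturated_adjoin_def)
    have "b * x + b * z = b * (x + z)"
      by (simp add: distrib_left)
    also have "\<dots> = b * p + (b * c) * a"
      unfolding x(2) by (simp add: algebra_simps)
    finally show "b * x \<in> saturated_adjoin P a"
      unfolding saturated_adjoin_def using is_idealD(3)[OF P x(1)] by blast
  qed
qed (auto simp: saturated_adjoin_def add.assoc)

lemma subset_saturated_adjoin: "P \<subseteq> saturated_adjoin P a"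
proof
  fix p
  assume "p \<in> P"
  moreover have "p + 0 = p + 0 * a"
    by simp
  ultimately show "p \<in> saturated_adjoin P a"
    unfolding saturated_adjoin_def by blast
qed

lemma mem_saturated_adjoin:
  assumes "is_ideal P"
  shows "a \<in> saturated_adjoin P a"
proof -
  have "a + 0 = 0 + 1 * a"
    by simp
  then show ?thesis
    unfolding saturated_adjoin_def using is_idealD(1)[OF assms] by blast
qed

text \<open>The product of the two upper bounds expands into terms that each have a factor
  \<open>p\<close>, \<open>q\<close> or \<open>a * b\<close>, so it lies in \<open>P\<close>;
  \<open>x * y\<close> is below it.\<close>

lemma mult_mem_of_saturated_adjoin:
  assumes P: "is_saturated_ideal P" and ab: "a * b \<in> P"
    and "x \<in> saturated_adjoin P a" "y \<in> saturated_adjoin P b"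
  shows "x * y \<in> P"
proof -
  have ideal: "is_ideal P"
    using P by (simp add: is_saturated_ideal_def)
  obtain p c z q d w where
    x: "p \<in> P" "x + z = p + c * a" and y: "q \<in> P" "y + w = q + d * b"
    using assms(3,4) by (auto simp: saturated_adjoin_def)
  have "x * y + (x * w + z * (y + w)) = (x + z) * (y + w)"
    by (simp add: algebra_simps)
  also have "\<dots> = q * p + (c * a) * q + ((d * b) * p + (c * d) * (a * b))"
    unfolding x(2) y(2) by (simp add: algebra_simps)
  also have "\<dots> \<in> P"
    by (intro is_idealD[OF ideal] x y ab)
  finally show ?thesis
    by (rule saturated_ideal_downward_closed[OF P])
qed

text \<open>Downward closure passes to unions directly, so no congruences have to be glued; the
  chain condition serves only for sums.\<close>

lemma saturated_ideal_Union_chain: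
  assumes "C \<noteq> {}" and sat: "\<And>J. J \<in> C \<Longrightarrow> is_saturated_ideal J"
    and chain: "\<And>J K. J \<in> C \<Longrightarrow> K \<in> C \<Longrightarrow> J \<subseteq> K \<or> K \<subseteq> J"
  shows "is_saturated_ideal (\<Union>C)"
proof (rule saturated_idealI)
  have ideal: "is_ideal J" if "J \<in> C" for J
    using sat[OF that] by (simp add: is_saturated_ideal_def)
  show "is_ideal (\<Union>C)"
    unfolding is_ideal_def
  proof (intro conjI allI ballI)
    show "0 \<in> \<Union>C"
      using \<open>C \<noteq> {}\<close> is_idealD(1)[OF ideal] by blast
  next
    fix x y
    assume "x \<in> \<Union>C" "y \<in> \<Union>C"
    then obtain J where "J \<in> C" "x \<in> J" "y \<in> J"
      using chain by (meson UnionE subsetD)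
    then show "x + y \<in> \<Union>C"
      using is_idealD(2)[OF ideal] by blast
  next
    fix a x
    assume "x \<in> \<Union>C"
    then show "a * x \<in> \<Union>C"
      using is_idealD(3)[OF ideal] by blast
  qed
next
  fix x y
  assume "x + y \<in> \<Union>C"
  then show "x \<in> \<Union>C"
    using saturated_ideal_downward_closed[OF sat] by blast
qed

lemma saturated_prime_avoiding:
  assumes I: "is_saturated_ideal I" and x: "x \<notin> radical I"
  obtains P where "P \<in> saturated_primes" "I \<subseteq> P" "x \<notin> P"
proof -
  define F where "F = {J. is_saturated_ideal J \<and> I \<subseteq> J \<and> (\<forall>n\<ge>1. x ^ n \<notin> J)}"
  have "\<exists>P\<in>F. \<forall>J\<in>F. P \<subseteq> J \<longrightarrow> J = P"
  proof (rule subset_Zorn_nonempty)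
    show "F \<noteq> {}"
      using I x by (auto simp: F_def radical_def)
  next
    fix C
    assume C: "C \<noteq> {}" "subset.chain F C"
    then have "C \<subseteq> F" and "\<And>J K. J \<in> C \<Longrightarrow> K \<in> C \<Longrightarrow> J \<subseteq> K \<or> K \<subseteq> J"
      by (auto simp: subset_chain_def)
    with C(1) have "is_saturated_ideal (\<Union>C)"
      by (intro saturated_ideal_Union_chain) (auto simp: F_def)
    with C(1) \<open>C \<subseteq> F\<close> show "\<Union>C \<in> F"
      by (fastforce simp: F_def)
  qed
  then obtain P where "P \<in> F" and max: "\<And>J. J \<in> F \<Longrightarrow> P \<subseteq> J \<Longrightarrow> J = P"
    by blast
  then have P: "is_saturated_ideal P" "I \<subseteq> P" and pow: "\<And>n. n \<ge> 1 \<Longrightarrow> x ^ n \<notin> P"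
    by (auto simp: F_def)
  have ideal: "is_ideal P"
    using P(1) by (simp add: is_saturated_ideal_def)
  have "x \<notin> P"
    using pow[of 1] by simp
  have power_mem: "\<exists>n\<ge>1. x ^ n \<in> saturated_adjoin P a" if "a \<notin> P" for a
  proof -
    \<comment> \<open>Otherwise maximality would make it equal to \<open>P\<close>, yet it contains
      \<open>a\<close>.\<close>
    have "saturated_adjoin P a \<notin> F"
      using max subset_saturated_adjoin mem_saturated_adjoin[OF ideal] that by metis
    then show ?thesis
      using P(2) subset_saturated_adjoin[of P a] saturated_adjoin_is_saturated[OF ideal]
      by (auto simp: F_def)
  qed
  have "a \<in> P \<or> b \<in> P" if "a * b \<in> P" for a b
  proof (rule ccontr)
    assume "\<not> (a \<in> P \<or> b \<in> P)"
    \<comment> \<open>One positive exponent is enough to make \<open>m + n\<close> positive.\<close>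
    then obtain m n where "m \<ge> 1" "x ^ m \<in> saturated_adjoin P a" "x ^ n \<in> saturated_adjoin P b"
      using power_mem by blast
    then have "x ^ (m + n) \<in> P" "m + n \<ge> 1"
      using mult_mem_of_saturated_adjoin[OF P(1) that] by (auto simp: power_add)
    then show False
      using pow by blast
  qed
  with ideal P(1) \<open>x \<notin> P\<close> have "P \<in> saturated_primes"
    by (auto simp: saturated_primes_def is_prime_ideal_def)
  with P(2) \<open>x \<notin> P\<close> show thesis
    using that by blast
qed

theorem proposition5p5:
  fixes I :: "'a::B1_algebra set"
  assumes "is_saturated_ideal I"
  shows "radical I = \<Inter>{P \<in> saturated_primes. I \<subseteq> P}"
proof
  show "radical I \<subseteq> \<Inter>{P \<in> saturated_primes. I \<subseteq> P}"
    using prime_ideal_power_mem by (fastforce simp: radical_def saturated_primes_def)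
  \<comment> \<open>By contraposition. This covers the empty intersection too: with no saturated
    prime above \<open>I\<close>, no element can avoid the radical.\<close>
  show "\<Inter>{P \<in> saturated_primes. I \<subseteq> P} \<subseteq> radical I"
    using saturated_prime_avoiding[OF assms] by blast
qed

end
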